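(* Let $\theta_1=\sum_{N\geq 1}3^{-N!}$ and $\theta_2=2\theta_1$. Then for every $\xi\in\mathbb{R}$, \[ \widehat{\omega}^{(3)}_{1,\theta_1}(\xi)+\widehat{\omega}^{(3)}_{1,\theta_2}(\xi)\leq 1 . \] In particular, for every $w>1/2$, $\mathcal{S}^{(3)}_{1,\theta_1}(w)\cap\mathcal{S}^{(3)}_{1,\theta_2}(w)=\emptyset$.
   Context: For $\xi,\theta\in\mathbb{R}$ and an integer $b\geq 2$, the uniform $b$-ary inhomogeneous exponent $\widehat{\omega}^{(b)}_{1,\theta}(\xi)$ is the supremum of $w\geq 0$ such that for all sufficiently large $Q$ the system $1\leq q\leq Q$, $|q\xi-p-\theta|\leq Q^{-w}$ has a solution with $q=b^N$ ($N$ a positive integer) and $p\in\mathbb{Z}$. For $w\geq 0$, $\mathcal{S}^{(b)}_{1,\theta}(w)$ is the set of $\xi\in\mathbb{R}$ such that for every $c>0$ and all sufficiently large $Q$ (depending on $c$) the system $1\leq q\leq Q$, $|q\xi-p-\theta|\leq cQ^{-w}$ has a solution with $q=b^N$ ($N$ a positive integer) and $p\in\mathbb{Z}$.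
   Formalization: The inequality is proved for every ξ not of the form (θ_i+p)/3^N with i∈{1,2}, N≥1, p∈ℤ; at those ξ, e.g. ξ=θ_1/3, the choice q=3^N gives error 0, so one exponent is infinite and the inequality fails. *)

theory Defs
  imports Complex_Main "HOL-Library.Extended_Real"
begin

definition b_ary_solvable :: "nat \<Rightarrow> real \<Rightarrow> real \<Rightarrow> real \<Rightarrow> real \<Rightarrow> bool" where
  "b_ary_solvable b \<theta> \<xi> Q \<epsilon> \<longleftrightarrow>
     (\<exists>N\<ge>1. \<exists>q::nat. \<exists>p::int. q = b ^ N \<and> 1 \<le> q \<and> real q \<le> Q \<and>
        \<bar>real q * \<xi> - real_of_int p - \<theta>\<bar> \<le> \<epsilon>)"

text \<open>
  The supremum is taken in the extended reals: it is infinite as soon as some power of \<open>b\<close>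
  solves the inequality with error exactly \<open>0\<close>, see \<open>omega_hat_eq_infinity\<close> below.
\<close>

definition omega_hat :: "nat \<Rightarrow> real \<Rightarrow> real \<Rightarrow> ereal" where
  "omega_hat b \<theta> \<xi> =
     Sup (ereal ` {w. 0 \<le> w \<and> (\<forall>\<^sub>F Q in at_top. b_ary_solvable b \<theta> \<xi> Q (Q powr (- w)))})"

definition S_set :: "nat \<Rightarrow> real \<Rightarrow> real \<Rightarrow> real set" where
  "S_set b \<theta> w =
     {\<xi>. \<forall>c>0. \<forall>\<^sub>F Q in at_top. b_ary_solvable b \<theta> \<xi> Q (c * Q powr (- w))}"

definition theta1 :: real where
  "theta1 = (\<Sum>N. 1 / 3 ^ fact (Suc N))"

definition theta2 :: real where
  "theta2 = 2 * theta1"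

lemma summable_theta1: "summable (\<lambda>N. 1 / 3 ^ fact (Suc N) :: real)"
proof (rule summable_comparison_test')
  show "summable (\<lambda>N. (1 / 3) ^ N :: real)"
    by (rule summable_geometric) simp
  fix N :: nat
  have "N \<le> fact (Suc N)"
    using fact_ge_self[of "Suc N"] by linarith
  then have "(3::real) ^ N \<le> 3 ^ fact (Suc N)"
    by (intro power_increasing) simp_all
  then show "norm (1 / 3 ^ fact (Suc N) :: real) \<le> (1 / 3) ^ N"
    by (simp add: power_one_over frac_le del: fact_Suc)
qed

lemma omega_hat_eq_infinity:
  assumes "b \<ge> 1" "N \<ge> 1" "real b ^ N * \<xi> - real_of_int p = \<theta>"
  shows "omega_hat b \<theta> \<xi> = \<infinity>"
proof -
  have solv: "\<forall>\<^sub>F Q in at_top. b_ary_solvable b \<theta> \<xi> Q (Q powr (- w))" for w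
    using eventually_ge_at_top[of "real b ^ N"]
  proof eventually_elim
    case (elim Q)
    have "b ^ N = b ^ N \<and> 1 \<le> b ^ N \<and> real (b ^ N) \<le> Q \<and>
        \<bar>real (b ^ N) * \<xi> - real_of_int p - \<theta>\<bar> \<le> Q powr (- w)"
      using assms elim by simp
    with assms(2) show ?case unfolding b_ary_solvable_def by blast
  qed
  have "ereal (real n) \<le> omega_hat b \<theta> \<xi>" for n
    unfolding omega_hat_def by (rule Sup_upper) (use solv in auto)
  then show ?thesis
    by (metis ereal_less_eq(3) ereal_top linorder_not_le order.trans real_arch_simple)
qed

text \<open>
  The bound \<open>\<le> 1\<close> for the sum of the two exponents therefore fails at every \<open>\<xi>\<close> of the form
  \<open>(\<theta>\<^sub>i + p) / 3\<^sup>N\<close> with \<open>N \<ge> 1\<close> and \<open>p\<close> an integer (for instance at \<open>\<theta>\<^sub>1 / 3\<close>).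
\<close>

lemma omega_hat_sum_eq_infinity:
  assumes "N \<ge> 1"
    and "3 ^ N * \<xi> - real_of_int p = theta1 \<or> 3 ^ N * \<xi> - real_of_int p = theta2"
  shows "omega_hat 3 theta1 \<xi> + omega_hat 3 theta2 \<xi> = \<infinity>"
  using assms omega_hat_eq_infinity[of 3 N \<xi> p theta1] omega_hat_eq_infinity[of 3 N \<xi> p theta2]
  by auto

end

theory Submission
  imports Defs
begin

text \<open>
  In base 3 the digits of \<open>theta1\<close> are 1 at the positions \<open>k!\<close> and 0 elsewhere. A proper shift
  of the expansion of \<open>theta1\<close> or \<open>theta2\<close> therefore never starts like \<open>theta1\<close> or
  \<open>theta2\<close>, which both begin with two equal nonzero digits. So if \<open>3\<^sup>N \<xi>\<close> is close to one of the
  two numbers modulo 1 with error \<open>\<epsilon>\<close>, then no \<open>3\<^sup>M \<xi>\<close> is close to one of them for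
  \<open>N < M < N - log\<^sub>3 \<epsilon> - O(1)\<close>. Let \<open>3\<^sup>X \<xi>\<close> be close to one of the two numbers, and
  take the solutions \<open>N, M < X\<close> belonging to \<open>Q = 3\<^bsup>X-1\<^esup>\<close>. The gaps between
  \<open>N\<close>, \<open>M\<close> and \<open>X\<close> have lengths at least \<open>w X - O(1)\<close> and \<open>w' X - O(1)\<close> in some order and
  fit into \<open>[0, X]\<close>, whence \<open>w + w' \<le> 1\<close>.
\<close>

text \<open>The margin \<open>1 / 30\<close> is a convenient choice: the distances estimated below
  all exceed \<open>1 / 10\<close>. Half of it is later granted to each of two approximation
  errors.\<close>

definition far_from_Ints :: "real \<Rightarrow> bool" where
  "far_from_Ints x \<longleftrightarrow> (\<forall>p::int. 1 / 30 \<le> \<bar>x - of_int p\<bar>)"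

lemma far_from_IntsI:
  fixes k :: int
  assumes "of_int k + 1 / 30 \<le> x" "x \<le> of_int k + 29 / 30"
  shows "far_from_Ints x"
  unfolding far_from_Ints_def
proof
  fix p :: int
  consider "p \<le> k" | "k + 1 \<le> p" by linarith
  then show "1 / 30 \<le> \<bar>x - of_int p\<bar>"
  proof cases
    case 1
    then have "(of_int p :: real) \<le> of_int k" by simp
    with assms show ?thesis by linarith
  next
    case 2
    then have "(of_int (k + 1) :: real) \<le> of_int p" by (simp only: of_int_le_iff)
    with assms show ?thesis by simp
  qed
qed

section \<open>Ternary expansion of \<open>theta1\<close> and its shifts\<close>

lemma fact_Suc_gap:
  assumes "1 \<le> j"
  shows "fact (Suc j) + 4 + n \<le> (fact (Suc (Suc n + j)) :: nat)"
proof (induction n)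
  case 0
  have "(2::nat) \<le> fact (Suc j)"
    using fact_ge_self[of "Suc j"] assms by linarith
  then have "2 * 2 \<le> Suc j * (fact (Suc j) :: nat)"
    using assms by (intro mult_le_mono) auto
  then show ?case
    by (simp add: algebra_simps)
next
  case (Suc n)
  have "(fact (Suc (Suc n + j)) :: nat) < fact (Suc (Suc (Suc n) + j))"
    by (rule fact_less_mono) auto
  with Suc show ?case by linarith
qed

definition theta1_tail :: "nat \<Rightarrow> real" where
  "theta1_tail j = (\<Sum>n. 1 / 3 ^ fact (Suc (n + j)))"

text \<open>By \<open>fact_Suc_gap\<close> the terms after the first are dominated by a geometric
  series of ratio \<open>1 / 3\<close> that starts at \<open>1 / 81\<close> of the first term, hence
  adds up to \<open>1 / 54\<close> of it. The 4 in \<open>fact_Suc_gap\<close> is best possible at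
  \<open>j = 1\<close>, since \<open>3! = 2! + 4\<close>.\<close>

lemma theta1_tail_bounds:
  assumes "1 \<le> j"
  shows "1 / 3 ^ fact (Suc j) \<le> theta1_tail j"
    and "theta1_tail j \<le> 55 / 54 * (1 / 3 ^ fact (Suc j))"
proof -
  let ?f = "\<lambda>n. 1 / 3 ^ fact (Suc (n + j)) :: real"
  let ?a = "1 / 3 ^ fact (Suc j) :: real"
  have sf: "summable ?f"
    using summable_theta1 by (rule summable_ignore_initial_segment)
  then have sf': "summable (\<lambda>n. ?f (Suc n))"
    by (subst summable_Suc_iff)
  have split: "theta1_tail j = ?a + (\<Sum>n. ?f (Suc n))"
    unfolding theta1_tail_def using suminf_split_head[OF sf] by simp
  have "0 \<le> (\<Sum>n. ?f (Suc n))"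
    by (rule suminf_nonneg[OF sf']) simp
  then show "?a \<le> theta1_tail j"
    using split by linarith
  have geo: "(\<lambda>n. ?a / 81 * (1 / 3) ^ n) sums (?a / 81 * (1 / (1 - 1 / 3)))"
    by (intro sums_mult geometric_sums) simp
  have "?f (Suc n) \<le> ?a / 81 * (1 / 3) ^ n" for n
  proof -
    have "(3::real) ^ (fact (Suc j) + 4 + n) \<le> 3 ^ fact (Suc (Suc n + j))"
      using fact_Suc_gap[OF assms] by (intro power_increasing) simp_all
    then have "?f (Suc n) \<le> 1 / 3 ^ (fact (Suc j) + 4 + n)"
      by (intro divide_left_mono) simp_all
    also have "\<dots> = ?a / 81 * (1 / 3) ^ n"
      by (simp add: power_add power_one_over del: fact_Suc)
    finally show ?thesis .
  qed
  then have "(\<Sum>n. ?f (Suc n)) \<le> (\<Sum>n. ?a / 81 * (1 / 3) ^ n)"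
    using sf' sums_summable[OF geo] by (rule suminf_le)
  also have "\<dots> = ?a / 54"
    using sums_unique[OF geo] by simp
  finally have "theta1_tail j \<le> ?a + ?a / 54"
    unfolding split by (rule add_left_mono)
  also have "\<dots> = 55 / 54 * ?a"
    by (simp del: fact_Suc)
  finally show "theta1_tail j \<le> 55 / 54 * ?a" .
qed

lemma theta1_eq_tail:
  "theta1 = (\<Sum>n<j. 1 / 3 ^ fact (Suc n)) + theta1_tail j"
  unfolding theta1_def theta1_tail_def
  using suminf_split_initial_segment[OF summable_theta1, of j] by simp

lemma theta1_bounds: "4 / 9 \<le> theta1" "theta1 \<le> 217 / 486"
  using theta1_eq_tail[of 1] theta1_tail_bounds[of 1] by simp_all

text \<open>With \<open>j\<close> least such that \<open>m < (j + 1)!\<close>, the digits at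
  positions up to \<open>m\<close> form the integer \<open>z\<close>, and \<open>x\<close> is the
  shifted tail, whose leading term is \<open>1 / 3 ^ d\<close> with \<open>d = (j + 1)! - m\<close>.
  The two ranges of \<open>x\<close> come from \<open>d \<ge> 2\<close> and
  \<open>d = 1\<close>.\<close>

lemma shift_theta1:
  assumes "1 \<le> m"
  obtains z :: int and x :: real
  where "3 ^ m * theta1 = of_int z + x"
    and "0 \<le> x \<and> x \<le> 55 / 486 \<or> 1 / 3 \<le> x \<and> x \<le> 55 / 162"
proof -
  have "\<exists>j. m < fact (Suc j)"
    using fact_ge_self[of "Suc m"] by (intro exI[of _ m]) linarith
  then obtain j where j: "m < fact (Suc j)" and least: "\<forall>i<j. \<not> m < fact (Suc i)"
    using exists_least_iff[of "\<lambda>j. m < fact (Suc j)"] by auto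
  from j assms have j1: "1 \<le> j"
    by (cases j) auto
  obtain d where d: "fact (Suc j) = m + d" "1 \<le> d"
    using j by (metis less_imp_add_positive Suc_leI One_nat_def)
  define z where "z = (\<Sum>n<j. (3::int) ^ (m - fact (Suc n)))"
  define x where "x = 3 ^ m * theta1_tail j"
  have "(3::real) ^ m * (1 / 3 ^ fact (Suc n)) = 3 ^ (m - fact (Suc n))" if "n < j" for n
  proof -
    have "fact (Suc n) \<le> m"
      using least that by (simp add: not_less del: fact_Suc)
    then show ?thesis
      by (subst power_diff) (simp_all del: fact_Suc)
  qed
  then have "3 ^ m * (\<Sum>n<j. 1 / 3 ^ fact (Suc n)) = real_of_int z"
    unfolding z_def sum_distrib_left of_int_sum of_int_power of_int_numeral
    by (intro sum.cong) auto
  then have "3 ^ m * theta1 = of_int z + x"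
    by (simp add: theta1_eq_tail[of j] x_def distrib_left)
  moreover have x: "1 / 3 ^ d \<le> x" "x \<le> 55 / 54 * (1 / 3 ^ d)"
    using mult_left_mono[OF theta1_tail_bounds(1)[OF j1], of "3 ^ m"]
      mult_left_mono[OF theta1_tail_bounds(2)[OF j1], of "3 ^ m"]
    by (simp_all add: x_def d power_add del: fact_Suc)
  have "0 \<le> x \<and> x \<le> 55 / 486 \<or> 1 / 3 \<le> x \<and> x \<le> 55 / 162"
  proof (cases "d = 1")
    case True
    with x show ?thesis by simp
  next
    case False
    with d have "(3::real) ^ 2 \<le> 3 ^ d"
      by (intro power_increasing) auto
    then have "1 / 3 ^ d \<le> (1 / 9 :: real)"
      by (intro divide_left_mono) simp_all
    moreover have "(0::real) \<le> 1 / 3 ^ d" by simp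
    ultimately show ?thesis using x by linarith
  qed
  ultimately show ?thesis by (rule that)
qed

section \<open>Separation of shifts from \<open>theta1\<close> and \<open>theta2\<close> modulo
  1\<close>

lemma far_theta1_theta1:
  assumes "1 \<le> m"
  shows "far_from_Ints (3 ^ m * theta1 - theta1)"
proof -
  obtain z :: int and x where *: "3 ^ m * theta1 = of_int z + x"
    "0 \<le> x \<and> x \<le> 55 / 486 \<or> 1 / 3 \<le> x \<and> x \<le> 55 / 162"
    using shift_theta1[OF assms] .
  \<comment> \<open>Both ranges of \<open>x\<close> lie below \<open>theta1\<close>, so the
    difference falls strictly between \<open>z - 1\<close> and \<open>z\<close>.\<close>
  show ?thesis
    by (rule far_from_IntsI[of "z - 1"]) (use * theta1_bounds in auto)
qed

lemma far_theta1_theta2: "far_from_Ints (3 ^ m * theta1 - theta2)"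
proof (cases "m = 0")
  case True
  \<comment> \<open>Without a shift the difference is \<open>- theta1\<close>.\<close>
  then show ?thesis
    by (intro far_from_IntsI[of "-1"]) (use theta1_bounds in \<open>auto simp: theta2_def\<close>)
next
  case False
  then have "1 \<le> m" by simp
  then obtain z :: int and x where *: "3 ^ m * theta1 = of_int z + x"
    "0 \<le> x \<and> x \<le> 55 / 486 \<or> 1 / 3 \<le> x \<and> x \<le> 55 / 162"
    by (rule shift_theta1)
  show ?thesis
    by (rule far_from_IntsI[of "z - 1"]) (use * theta1_bounds in \<open>auto simp: theta2_def\<close>)
qed

lemma far_theta2_theta1: "far_from_Ints (3 ^ m * theta2 - theta1)"
proof (cases "m = 0")
  case True
  then show ?thesis
    by (intro far_from_IntsI[of 0]) (use theta1_bounds in \<open>auto simp: theta2_def\<close>)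
next
  case False
  then have "1 \<le> m" by simp
  then obtain z :: int and x where *: "3 ^ m * theta1 = of_int z + x"
    and x: "0 \<le> x \<and> x \<le> 55 / 486 \<or> 1 / 3 \<le> x \<and> x \<le> 55 / 162"
    by (rule shift_theta1)
  have eq: "3 ^ m * theta2 = of_int (2 * z) + 2 * x"
    using * by (simp add: theta2_def)
  \<comment> \<open>The sign of \<open>2 * x - theta1\<close> differs between the two ranges, and so
    do the enclosing integers.\<close>
  from x show ?thesis
  proof
    assume "0 \<le> x \<and> x \<le> 55 / 486"
    then show ?thesis
      unfolding eq by (intro far_from_IntsI[of "2 * z - 1"]) (use theta1_bounds in auto)
  next
    assume "1 / 3 \<le> x \<and> x \<le> 55 / 162"
    then show ?thesis
      unfolding eq by (intro far_from_IntsI[of "2 * z"]) (use theta1_bounds in auto)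
  qed
qed

lemma far_theta2_theta2:
  assumes "1 \<le> m"
  shows "far_from_Ints (3 ^ m * theta2 - theta2)"
proof -
  obtain z :: int and x where *: "3 ^ m * theta1 = of_int z + x"
    and x: "0 \<le> x \<and> x \<le> 55 / 486 \<or> 1 / 3 \<le> x \<and> x \<le> 55 / 162"
    using shift_theta1[OF assms] .
  have eq: "3 ^ m * theta2 = of_int (2 * z) + 2 * x"
    using * by (simp add: theta2_def)
  show ?thesis
    unfolding eq
    by (rule far_from_IntsI[of "2 * z - 1"]) (use x theta1_bounds in \<open>auto simp: theta2_def\<close>)
qed

section \<open>The gap principle\<close>

definition near_mod1 :: "real \<Rightarrow> real \<Rightarrow> nat \<Rightarrow> real \<Rightarrow> bool" where
  "near_mod1 \<theta> \<xi> N \<epsilon> \<longleftrightarrow> (\<exists>p::int. \<bar>3 ^ N * \<xi> - of_int p - \<theta>\<bar> \<le> \<epsilon>)"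

lemma near_mod1_mono: "near_mod1 \<theta> \<xi> N \<epsilon> \<Longrightarrow> \<epsilon> \<le> \<delta> \<Longrightarrow> near_mod1 \<theta> \<xi> N \<delta>"
  unfolding near_mod1_def by (meson order_trans)

text \<open>Multiply the approximation at \<open>N\<close> by \<open>3 ^ m\<close> and compare it
  with the one at \<open>N + m\<close>: modulo 1, \<open>3 ^ m * \<theta> - \<theta>'\<close> is the
  difference of the two errors. The second error uses up at most half of the margin, so the first
  one, magnified by \<open>3 ^ m\<close>, is at least \<open>1 / 60\<close>.\<close>

lemma near_mod1_gap:
  assumes "near_mod1 \<theta> \<xi> N ((3 ^ Y) powr - w)" "near_mod1 \<theta>' \<xi> (N + m) (1 / 60)"
    and far: "far_from_Ints (3 ^ m * \<theta> - \<theta>')"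
  shows "w * real Y - 4 < real m"
proof -
  obtain p p' :: int
    where p: "\<bar>3 ^ N * \<xi> - of_int p - \<theta>\<bar> \<le> (3 ^ Y) powr - w"
      and p': "\<bar>3 ^ (N + m) * \<xi> - of_int p' - \<theta>'\<bar> \<le> 1 / 60"
    using assms unfolding near_mod1_def by auto
  let ?e = "3 ^ N * \<xi> - of_int p - \<theta>"
  have eq: "3 ^ m * \<theta> - \<theta>' - of_int (p' - 3 ^ m * p)
      = (3 ^ (N + m) * \<xi> - of_int p' - \<theta>') - 3 ^ m * ?e"
    by (simp add: algebra_simps power_add)
  have "1 / 30 \<le> \<bar>(3 ^ (N + m) * \<xi> - of_int p' - \<theta>') - 3 ^ m * ?e\<bar>"
    using far unfolding far_from_Ints_def eq[symmetric] by blast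
  then have "1 / 60 \<le> \<bar>3 ^ m * ?e\<bar>"
    using p' by linarith
  also have "\<dots> \<le> 3 ^ m * (3 ^ Y) powr - w"
    using p by (simp add: abs_mult)
  also have "\<dots> = 3 powr (real m - w * real Y)"
    by (simp add: powr_realpow[symmetric] powr_powr powr_add[symmetric] algebra_simps)
  finally have "1 / 60 \<le> (3::real) powr (real m - w * real Y)" .
  \<comment> \<open>This is the source of the 4 in the conclusion: 81 is the first power of 3 above
    60.\<close>
  moreover have "(3::real) powr (- 4) < 1 / 60"
    by (simp add: powr_minus powr_numeral)
  ultimately have "(3::real) powr (- 4) < 3 powr (real m - w * real Y)"
    by linarith
  then show ?thesis
    by simp
qed

section \<open>Solutions for all large \<open>Q\<close>\<close>

definition uniformly_solvable :: "real \<Rightarrow> real \<Rightarrow> real \<Rightarrow> bool" where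
  "uniformly_solvable \<theta> \<xi> w \<longleftrightarrow> (\<forall>\<^sub>F Q in at_top. b_ary_solvable 3 \<theta> \<xi> Q (Q powr - w))"

lemma b_ary_solvable_3:
  assumes "b_ary_solvable 3 \<theta> \<xi> Q \<epsilon>"
  obtains N where "1 \<le> N" "3 ^ N \<le> Q" "near_mod1 \<theta> \<xi> N \<epsilon>"
  using assms unfolding b_ary_solvable_def near_mod1_def by auto

lemma filterlim_power_3: "filterlim (\<lambda>Y. (3::real) ^ Y) at_top sequentially"
proof (rule filterlim_at_top_mono[OF filterlim_real_sequentially])
  have "real Y \<le> 3 ^ Y" for Y
    using Bernoulli_inequality[of 2 Y] by simp
  then show "\<forall>\<^sub>F Y in sequentially. real Y \<le> 3 ^ Y" by simp
qed

text \<open>Sampling at \<open>Q = 3 ^ Y\<close> turns the size constraint on \<open>q\<close> into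
  \<open>N \<le> Y\<close>.\<close>

lemma uniformly_solvable_power_3:
  assumes "uniformly_solvable \<theta> \<xi> w"
  shows "\<forall>\<^sub>F Y in sequentially. \<exists>N\<le>Y. near_mod1 \<theta> \<xi> N ((3 ^ Y) powr - w)"
proof -
  from assms filterlim_power_3
  have "\<forall>\<^sub>F Y in sequentially. b_ary_solvable 3 \<theta> \<xi> (3 ^ Y) ((3 ^ Y) powr - w)"
    unfolding uniformly_solvable_def by (rule eventually_compose_filterlim)
  then show ?thesis
  proof eventually_elim
    case (elim Y)
    then obtain N where "3 ^ N \<le> (3::real) ^ Y" "near_mod1 \<theta> \<xi> N ((3 ^ Y) powr - w)"
      by (rule b_ary_solvable_3)
    then show ?case by auto
  qed
qed

lemma eventually_powr_less:
  assumes "0 < w" "0 < (\<delta>::real)"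
  shows "\<forall>\<^sub>F Q in at_top. Q powr - w < \<delta>"
proof -
  have "((\<lambda>Q::real. Q powr - w) \<longlongrightarrow> 0) at_top"
    using assms(1) by (intro tendsto_neg_powr filterlim_ident) auto
  then show ?thesis
    using assms(2) by (rule order_tendstoD)
qed

text \<open>One solution may serve both as the start of a gap, which needs the sharp error, and as
  the end of another, which needs the error \<open>1 / 60\<close>.\<close>

lemma eventually_near_mod1:
  assumes "uniformly_solvable \<theta> \<xi> w" "0 < w"
  shows "\<forall>\<^sub>F Y in sequentially. \<exists>N\<le>Y.
    near_mod1 \<theta> \<xi> N ((3 ^ Y) powr - w) \<and> near_mod1 \<theta> \<xi> N (1 / 60)"
proof -
  have "\<forall>\<^sub>F Y in sequentially. ((3::real) ^ Y) powr - w < 1 / 60"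
    using eventually_powr_less[OF assms(2), of "1 / 60"]
    by (intro eventually_compose_filterlim[OF _ filterlim_power_3]) simp
  with uniformly_solvable_power_3[OF assms(1)] show ?thesis
    by eventually_elim (meson near_mod1_mono less_imp_le)
qed

text \<open>Without exact hits, each of the finitely many \<open>N\<close> in \<open>{1..K}\<close>
  has a positive least error. Once \<open>Q powr - w\<close> is below all of these, a solution must
  use a larger \<open>N\<close>.\<close>

lemma near_mod1_unbounded:
  assumes "uniformly_solvable \<theta> \<xi> w" "0 < w"
    and nonexact: "\<And>N p. 1 \<le> N \<Longrightarrow> 3 ^ N * \<xi> - of_int p \<noteq> \<theta>"
  shows "\<exists>X\<ge>K. near_mod1 \<theta> \<xi> X (1 / 60)"
proof -
  have "\<forall>\<^sub>F Q in at_top. Q powr - w < \<bar>(3 ^ N * \<xi> - \<theta>) - of_int (round (3 ^ N * \<xi> - \<theta>))\<bar>"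
    if "N \<in> {1..K}" for N
    \<comment> \<open>Rounding picks the best \<open>p\<close>, so this is the least error
      attainable at \<open>N\<close>.\<close>
    using nonexact[of N "round (3 ^ N * \<xi> - \<theta>)"] that
    by (intro eventually_powr_less assms) auto
  then have "\<forall>\<^sub>F Q in at_top. \<forall>N\<in>{1..K}.
      Q powr - w < \<bar>(3 ^ N * \<xi> - \<theta>) - of_int (round (3 ^ N * \<xi> - \<theta>))\<bar>"
    by (intro eventually_ball_finite) auto
  moreover have "\<forall>\<^sub>F Q in at_top. Q powr - w < 1 / 60"
    by (intro eventually_powr_less assms) auto
  moreover have "\<forall>\<^sub>F Q in at_top. b_ary_solvable 3 \<theta> \<xi> Q (Q powr - w)"
    using assms(1) unfolding uniformly_solvable_def .
  ultimately have "\<forall>\<^sub>F Q :: real in at_top. \<exists>X\<ge>K. near_mod1 \<theta> \<xi> X (1 / 60)"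
  proof eventually_elim
    case (elim Q)
    from elim(3) obtain N where N: "1 \<le> N" "near_mod1 \<theta> \<xi> N (Q powr - w)"
      by (rule b_ary_solvable_3)
    then obtain p :: int where "\<bar>3 ^ N * \<xi> - of_int p - \<theta>\<bar> \<le> Q powr - w"
      unfolding near_mod1_def by blast
    then have "\<bar>(3 ^ N * \<xi> - \<theta>) - of_int p\<bar> \<le> Q powr - w"
      by (simp add: algebra_simps)
    with round_diff_minimal[of "3 ^ N * \<xi> - \<theta>" p]
    have "\<not> Q powr - w < \<bar>(3 ^ N * \<xi> - \<theta>) - of_int (round (3 ^ N * \<xi> - \<theta>))\<bar>"
      by linarith
    with elim(1) have "N \<notin> {1..K}" by blast
    moreover have "near_mod1 \<theta> \<xi> N (1 / 60)"
      using N(2) elim(2) by (meson near_mod1_mono less_imp_le)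
    ultimately show ?case
      using N(1) by (intro exI[of _ N]) auto
  qed
  \<comment> \<open>The assertion does not depend on \<open>Q\<close>, and \<open>at_top\<close> is
    a nontrivial filter.\<close>
  then show ?thesis
    by (simp add: trivial_limit_at_top_linorder)
qed

section \<open>Bounds on admissible exponents\<close>

lemma uniformly_solvable_le_1:
  assumes "uniformly_solvable \<theta> \<xi> w"
    and nonexact: "\<And>N p. 1 \<le> N \<Longrightarrow> 3 ^ N * \<xi> - of_int p \<noteq> \<theta>"
    and far: "\<And>m. 1 \<le> m \<Longrightarrow> far_from_Ints (3 ^ m * \<theta> - \<theta>)"
  shows "w \<le> 1"
proof (rule ccontr)
  assume "\<not> w \<le> 1"
  then have w: "0 < w" "0 < w - 1" by auto
  have "\<forall>\<^sub>F Y in sequentially. 5 / (w - 1) < real Y"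
    using filterlim_real_sequentially by (simp add: filterlim_at_top_dense)
  with uniformly_solvable_power_3[OF assms(1)]
  have "\<forall>\<^sub>F Y in sequentially. 5 / (w - 1) < real Y \<and>
      (\<exists>N\<le>Y. near_mod1 \<theta> \<xi> N ((3 ^ Y) powr - w))"
    by eventually_elim simp
  then obtain K where K: "\<And>Y. K \<le> Y \<Longrightarrow> 5 / (w - 1) < real Y \<and>
      (\<exists>N\<le>Y. near_mod1 \<theta> \<xi> N ((3 ^ Y) powr - w))"
    unfolding eventually_sequentially by blast
  obtain X where X: "Suc K \<le> X" "near_mod1 \<theta> \<xi> X (1 / 60)"
    using near_mod1_unbounded[OF assms(1) w(1) nonexact, of "Suc K"] by blast
  \<comment> \<open>Taking the solution for \<open>3 ^ Y\<close> with \<open>Y = X - 1\<close> puts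
    \<open>N\<close> strictly before \<open>X\<close>, as \<open>far\<close> requires.\<close>
  then obtain Y where Y: "X = Suc Y" "K \<le> Y"
    by (metis Suc_le_D Suc_le_mono)
  from K[OF Y(2)] obtain N where N: "N \<le> Y" "near_mod1 \<theta> \<xi> N ((3 ^ Y) powr - w)" by blast
  have "w * real Y - 4 < real (X - N)"
    by (rule near_mod1_gap[OF N(2) _ far]) (use X N Y in auto)
  also have "\<dots> \<le> real Y + 1"
    using Y by simp
  \<comment> \<open>The 5 is the 4 of the gap principle plus the 1 from
    \<open>X = Suc Y\<close>.\<close>
  finally have "(w - 1) * real Y < 5"
    by (simp add: algebra_simps)
  with K[OF Y(2)] w show False
    by (simp add: field_simps)
qed

text \<open>The roles are asymmetric, since the last index \<open>X\<close> belongs to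
  \<open>\<theta>\<close>. If \<open>N \<le> M\<close>, the gaps lead from \<open>\<theta>\<close>
  to \<open>\<theta>'\<close> and back to \<open>\<theta>\<close>; the case \<open>N = M\<close> is
  covered by \<open>far12\<close> at \<open>m = 0\<close>. Otherwise they lead from
  \<open>\<theta>'\<close> to \<open>\<theta>\<close> and on to \<open>\<theta>\<close> again, where
  \<open>far\<close> enters.\<close>

lemma uniformly_solvable_sum_le_1:
  assumes "uniformly_solvable \<theta> \<xi> w" "uniformly_solvable \<theta>' \<xi> w'" "0 < w" "0 < w'"
    and nonexact: "\<And>N p. 1 \<le> N \<Longrightarrow> 3 ^ N * \<xi> - of_int p \<noteq> \<theta>"
    and far: "\<And>m. 1 \<le> m \<Longrightarrow> far_from_Ints (3 ^ m * \<theta> - \<theta>)"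
    and far12: "\<And>m. far_from_Ints (3 ^ m * \<theta> - \<theta>')"
    and far21: "\<And>m. far_from_Ints (3 ^ m * \<theta>' - \<theta>)"
  shows "w + w' \<le> 1"
proof (rule ccontr)
  assume "\<not> w + w' \<le> 1"
  then have w: "0 < w + w' - 1" by auto
  have "\<forall>\<^sub>F Y in sequentially. 9 / (w + w' - 1) < real Y"
    using filterlim_real_sequentially by (simp add: filterlim_at_top_dense)
  with eventually_near_mod1[OF assms(1,3)] eventually_near_mod1[OF assms(2,4)]
  have "\<forall>\<^sub>F Y in sequentially. 9 / (w + w' - 1) < real Y \<and>
      (\<exists>N\<le>Y. near_mod1 \<theta> \<xi> N ((3 ^ Y) powr - w) \<and> near_mod1 \<theta> \<xi> N (1 / 60)) \<and>
      (\<exists>N\<le>Y. near_mod1 \<theta>' \<xi> N ((3 ^ Y) powr - w') \<and> near_mod1 \<theta>' \<xi> N (1 / 60))"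
    by eventually_elim blast
  then obtain K where K: "\<And>Y. K \<le> Y \<Longrightarrow> 9 / (w + w' - 1) < real Y \<and>
      (\<exists>N\<le>Y. near_mod1 \<theta> \<xi> N ((3 ^ Y) powr - w) \<and> near_mod1 \<theta> \<xi> N (1 / 60)) \<and>
      (\<exists>N\<le>Y. near_mod1 \<theta>' \<xi> N ((3 ^ Y) powr - w') \<and> near_mod1 \<theta>' \<xi> N (1 / 60))"
    unfolding eventually_sequentially by blast
  obtain X where X: "Suc K \<le> X" "near_mod1 \<theta> \<xi> X (1 / 60)"
    using near_mod1_unbounded[OF assms(1,3) nonexact, of "Suc K"] by blast
  then obtain Y where Y: "X = Suc Y" "K \<le> Y"
    by (metis Suc_le_D Suc_le_mono)
  from K[OF Y(2)] obtain N M
    where N: "N \<le> Y" "near_mod1 \<theta> \<xi> N ((3 ^ Y) powr - w)" "near_mod1 \<theta> \<xi> N (1 / 60)"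
      and M: "M \<le> Y" "near_mod1 \<theta>' \<xi> M ((3 ^ Y) powr - w')" "near_mod1 \<theta>' \<xi> M (1 / 60)"
    by blast
  have "w * real Y - 4 + (w' * real Y - 4) < real X"
  proof (cases "N \<le> M")
    case True
    have "w * real Y - 4 < real (M - N)"
      by (rule near_mod1_gap[OF N(2) _ far12]) (use True M in auto)
    moreover have "w' * real Y - 4 < real (X - M)"
      by (rule near_mod1_gap[OF M(2) _ far21]) (use M X Y in auto)
    moreover have "real (M - N) + real (X - M) \<le> real X"
      using True M Y by simp
    ultimately show ?thesis by linarith
  next
    case False
    have "w' * real Y - 4 < real (N - M)"
      by (rule near_mod1_gap[OF M(2) _ far21]) (use False N in auto)
    moreover have "w * real Y - 4 < real (X - N)"
      by (rule near_mod1_gap[OF N(2) _ far]) (use N X Y in auto)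
    moreover have "real (N - M) + real (X - N) \<le> real X"
      using False N Y by simp
    ultimately show ?thesis by linarith
  qed
  \<comment> \<open>Here 9 is 4 for each gap plus 1 from \<open>X = Suc Y\<close>.\<close>
  then have "(w + w' - 1) * real Y < 9"
    using Y by (simp add: algebra_simps)
  with K[OF Y(2)] w show False
    by (simp add: field_simps)
qed

text \<open>Two exact hits would make one of the numbers, modulo 1, a shift of the other, against
  their separation.\<close>

lemma theta_not_both_exact:
  assumes "3 ^ N * \<xi> - of_int p = theta1" "3 ^ M * \<xi> - of_int p' = theta2"
  shows False
proof (cases "N \<le> M")
  case True
  then have "(3::real) ^ M = 3 ^ (M - N) * 3 ^ N"
    by (simp flip: power_add)
  then have "3 ^ (M - N) * theta1 - theta2 = of_int (p' - 3 ^ (M - N) * p)"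
    by (simp add: assms[symmetric] algebra_simps)
  then show False
    using far_theta1_theta2[of "M - N"] unfolding far_from_Ints_def
    by (metis abs_zero diff_self not_one_le_zero zero_less_divide_1_iff zero_less_numeral not_less)
next
  case False
  then have "(3::real) ^ N = 3 ^ (N - M) * 3 ^ M"
    by (simp flip: power_add)
  then have "3 ^ (N - M) * theta2 - theta1 = of_int (p - 3 ^ (N - M) * p')"
    by (simp add: assms[symmetric] algebra_simps)
  then show False
    using far_theta2_theta1[of "N - M"] unfolding far_from_Ints_def
    by (metis abs_zero diff_self not_one_le_zero zero_less_divide_1_iff zero_less_numeral not_less)
qed

text \<open>At most one of the two numbers is hit exactly, so the other can take the part of
  \<open>\<theta>\<close> above, after exchanging the roles if necessary. The bound thus holds for
  every \<open>\<xi>\<close>.\<close>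

lemma theta_sum_le_1:
  assumes "uniformly_solvable theta1 \<xi> w" "uniformly_solvable theta2 \<xi> w'" "0 < w" "0 < w'"
  shows "w + w' \<le> 1"
proof (cases "\<exists>N\<ge>1. \<exists>p. 3 ^ N * \<xi> - real_of_int p = theta1")
  case False
  show ?thesis
    by (rule uniformly_solvable_sum_le_1[OF assms])
      (use False far_theta1_theta1 far_theta1_theta2 far_theta2_theta1 in blast)+
next
  case True
  have "w' + w \<le> 1"
    by (rule uniformly_solvable_sum_le_1[OF assms(2,1,4,3)])
      (use True theta_not_both_exact far_theta2_theta2 far_theta1_theta2 far_theta2_theta1 in blast)+
  then show ?thesis by simp
qed

section \<open>Passage to the suprema\<close>

lemma omega_hat_3:
  "omega_hat 3 \<theta> \<xi> = Sup (ereal ` {w. 0 \<le> w \<and> uniformly_solvable \<theta> \<xi> w})"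
  unfolding omega_hat_def uniformly_solvable_def ..

text \<open>Exponent 0 only asks for an error of at most 1, which rounding provides at
  \<open>q = 3\<close>. So the supremum is over a nonempty set and cannot be minus infinity.\<close>

lemma omega_hat_nonneg: "0 \<le> omega_hat 3 \<theta> \<xi>"
proof -
  have "\<forall>\<^sub>F Q in at_top. b_ary_solvable 3 \<theta> \<xi> Q (Q powr - 0)"
    using eventually_ge_at_top[of 3]
  proof eventually_elim
    case (elim Q)
    have "\<bar>3 * \<xi> - of_int (round (3 * \<xi> - \<theta>)) - \<theta>\<bar> \<le> 1"
      using of_int_round_abs_le[of "3 * \<xi> - \<theta>"] by linarith
    with elim show ?case
      unfolding b_ary_solvable_def by (intro exI[of _ 1] exI[of _ 3]) auto
  qed
  then have "ereal 0 \<in> ereal ` {w. 0 \<le> w \<and> uniformly_solvable \<theta> \<xi> w}"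
    unfolding uniformly_solvable_def by blast
  then show ?thesis
    unfolding omega_hat_3 zero_ereal_def by (rule Sup_upper)
qed

text \<open>An exact hit makes an exponent infinite, see \<open>omega_hat_sum_eq_infinity\<close>,
  so the first conjunct excludes such \<open>\<xi>\<close>. The second covers all
  \<open>\<xi>\<close>, because \<open>theta_sum_le_1\<close> does.\<close>

theorem theorem2p6:
  shows "(\<forall>\<xi>::real.
            (\<forall>N\<ge>1. \<forall>p::int. 3 ^ N * \<xi> - real_of_int p \<noteq> theta1 \<and>
                             3 ^ N * \<xi> - real_of_int p \<noteq> theta2) \<longrightarrow>
            omega_hat 3 theta1 \<xi> + omega_hat 3 theta2 \<xi> \<le> 1) \<and>
         (\<forall>w::real. w > 1 / 2 \<longrightarrow> S_set 3 theta1 w \<inter> S_set 3 theta2 w = {})"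
proof (intro conjI allI impI)
  fix \<xi> :: real
  assume nonexact: "\<forall>N\<ge>1. \<forall>p::int. 3 ^ N * \<xi> - real_of_int p \<noteq> theta1 \<and>
                                    3 ^ N * \<xi> - real_of_int p \<noteq> theta2"
  \<comment> \<open>Since \<open>theta_sum_le_1\<close> needs positive exponents, the individual
    bounds treat the pairs in which one exponent is 0.\<close>
  have le1: "w \<le> 1" if "uniformly_solvable theta1 \<xi> w" for w
    by (rule uniformly_solvable_le_1[OF that]) (use nonexact far_theta1_theta1 in auto)
  have le2: "w \<le> 1" if "uniformly_solvable theta2 \<xi> w" for w
    by (rule uniformly_solvable_le_1[OF that]) (use nonexact far_theta2_theta2 in auto)
  have sum_le: "w + w' \<le> 1"
    if "uniformly_solvable theta1 \<xi> w" "uniformly_solvable theta2 \<xi> w'" "0 \<le> w" "0 \<le> w'" for w w'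
    using theta_sum_le_1[OF that(1,2)] le1[OF that(1)] le2[OF that(2)] that(3,4)
    by (cases "w = 0 \<or> w' = 0") auto
  \<comment> \<open>The suprema are taken one at a time: first over \<open>w\<close> with
    \<open>w'\<close> fixed, then over \<open>w'\<close>.\<close>
  have bound: "omega_hat 3 theta1 \<xi> \<le> ereal (1 - w')"
    if "uniformly_solvable theta2 \<xi> w'" "0 \<le> w'" for w'
    unfolding omega_hat_3 using sum_le that by (intro Sup_least) (force simp: algebra_simps)
  have "omega_hat 3 theta1 \<xi> \<le> 1"
    unfolding omega_hat_3 using le1 by (intro Sup_least) auto
  \<comment> \<open>Lying between 0 and 1, the first exponent is a real number and can be moved to
    the other side.\<close>
  then obtain r where r: "omega_hat 3 theta1 \<xi> = ereal r"
    using omega_hat_nonneg[of theta1 \<xi>] by (cases "omega_hat 3 theta1 \<xi>") auto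
  have "omega_hat 3 theta2 \<xi> \<le> ereal (1 - r)"
    unfolding omega_hat_3[of theta2] using bound[unfolded r]
    by (intro Sup_least) (force simp: algebra_simps)
  then show "omega_hat 3 theta1 \<xi> + omega_hat 3 theta2 \<xi> \<le> 1"
    unfolding r by (cases "omega_hat 3 theta2 \<xi>") auto
next
  fix w :: real
  assume w: "1 / 2 < w"
  have "w + w \<le> 1" if "\<xi> \<in> S_set 3 theta1 w" "\<xi> \<in> S_set 3 theta2 w" for \<xi>
  proof (rule theta_sum_le_1)
    \<comment> \<open>This is the instance \<open>c = 1\<close> of membership in
      \<open>S_set\<close>.\<close>
    show "uniformly_solvable theta1 \<xi> w" "uniformly_solvable theta2 \<xi> w"
      using that unfolding S_set_def uniformly_solvable_def
      by (auto dest!: spec[of _ "1::real"])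
  qed (use w in auto)
  with w show "S_set 3 theta1 w \<inter> S_set 3 theta2 w = {}"
    by fastforce
qed

end
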